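(* Fix $n\in\mathbb{N}$ ($n\geq1$). Let $h=x^3-x\langle y,y\rangle+P_3(y)$ and $\widetilde{h}=x^3-x\langle y,y\rangle+\widetilde{P_3}(y)$ be elements of $\mathcal{C}_n$, and let $\mathcal{H}\subset\{h=1\}$, respectively $\widetilde{\mathcal{H}}\subset\{\widetilde{h}=1\}$, denote the corresponding CCPSR manifolds containing the point $(x,y)=(1,0)$ (i.e. the connected components of these level sets containing $(1,0)$). Then the smooth curve $$\gamma:[0,1]\to\mathcal{C}_n\subset\mathrm{Sym}^3(\mathbb{R}^{n+1})^*,\qquad \gamma(t)=(1-t)h+t\widetilde{h},$$ (which indeed takes values in $\mathcal{C}_n$) defines, for every $t\in[0,1]$, an $n$-dimensional CCPSR manifold $\mathcal{H}_t\subset\{\gamma(t)=1\}$ as the connected component containing $(1,0)$, and $\mathcal{H}_0=\mathcal{H}$, $\mathcal{H}_1=\widetilde{\mathcal{H}}$.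
   Context: Write linear coordinates on $\mathbb{R}^{n+1}$ as $(x,y)=(x,y_1,\ldots,y_n)$; $\langle\cdot,\cdot\rangle$ and $\|\cdot\|$ denote the standard Euclidean scalar product and norm on $\mathbb{R}^n$. $\mathrm{Sym}^3(\mathbb{R}^m)^*$ is the space of homogeneous cubic polynomials on $\mathbb{R}^m$. Define $$\mathcal{C}_n:=\left\{x^3-x\langle y,y\rangle+P_3(y)\ \middle|\ P_3\in\mathrm{Sym}^3(\mathbb{R}^n)^*,\ \max_{\|y\|=1}P_3(y)\leq\frac{2}{3\sqrt{3}}\right\}.$$ Let $h:\mathbb{R}^{n+1}\to\mathbb{R}$ be a homogeneous cubic polynomial and $\partial^2h_p$ its Hessian bilinear form at $p$. A point $p$ with $h(p)>0$ is a hyperbolic point of $h$ if $-\partial^2h_p$ has signature $(n,1)$ ($n$ positive, one negative direction). An $n$-dimensional CCPSR (closed connected projective special real) manifold is a nonempty (relatively) open subset of a level set $\{h=1\}\subset\mathbb{R}^{n+1}$ of such an $h$, consisting only of hyperbolic points of $h$, which is connected and closed as a subset of $\mathbb{R}^{n+1}$. (For every $h\in\mathcal{C}_n$ the connected component of $\{h=1\}$ containing $(1,0)$ is a CCPSR manifold.) *)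

theory Defs
  imports "HOL-Analysis.Analysis"
begin

text \<open>
  Polynomials on a Euclidean space are identified with the functions they induce.
  The space \<open>\<real>\<^sup>n\<^sup>+\<^sup>1\<close> with linear coordinates \<open>(x, y)\<close> is the type
  \<open>real \<times> real ^ 'n\<close>, with \<open>n = CARD('n) \<ge> 1\<close>.
\<close>

definition cubic_form :: "('a \<Rightarrow> 'a \<Rightarrow> 'a \<Rightarrow> real) \<Rightarrow> 'a :: euclidean_space \<Rightarrow> real" where
  "cubic_form a v =
     (\<Sum>i\<in>Basis. \<Sum>j\<in>Basis. \<Sum>k\<in>Basis. a i j k * (v \<bullet> i) * (v \<bullet> j) * (v \<bullet> k))"

definition homogeneous_cubics :: "('a :: euclidean_space \<Rightarrow> real) set" where
  "homogeneous_cubics = range cubic_form"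

definition standard_form :: "(real ^ 'n \<Rightarrow> real) \<Rightarrow> real \<times> (real ^ 'n) \<Rightarrow> real" where
  "standard_form P = (\<lambda>(x, y). x ^ 3 - x * (y \<bullet> y) + P y)"

text \<open>
  The set \<open>\<C>\<^sub>n\<close>. The supremum is a maximum, as a cubic form is continuous and the unit
  sphere is compact and nonempty.
\<close>

definition generating_set :: "(real \<times> (real ^ 'n) \<Rightarrow> real) set" where
  "generating_set =
     {standard_form P | P. P \<in> homogeneous_cubics \<and>
        (SUP y\<in>sphere 0 1. P y) \<le> 2 / (3 * sqrt 3)}"

definition hessian :: "('a :: real_normed_vector \<Rightarrow> real) \<Rightarrow> 'a \<Rightarrow> 'a \<Rightarrow> 'a \<Rightarrow> real" where
  "hessian h p v w =
     frechet_derivative (\<lambda>q. frechet_derivative h (at q) v) (at p) w"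

text \<open>
  Signature in the sense of Sylvester: the form is diagonal in some basis, with \<open>r\<close> positive
  and \<open>s\<close> negative diagonal entries. Orthogonality is required for both orders of each pair
  of basis vectors, so such a form is symmetric.
\<close>

definition has_signature ::
    "('a :: euclidean_space \<Rightarrow> 'a \<Rightarrow> real) \<Rightarrow> nat \<Rightarrow> nat \<Rightarrow> bool" where
  "has_signature \<beta> r s \<longleftrightarrow> bilinear \<beta> \<and>
     (\<exists>S. independent S \<and> span S = UNIV \<and>
          (\<forall>u\<in>S. \<forall>v\<in>S. u \<noteq> v \<longrightarrow> \<beta> u v = 0) \<and>
          card {u \<in> S. \<beta> u u > 0} = r \<and> card {u \<in> S. \<beta> u u < 0} = s)"

definition hyperbolic_point ::
    "(real \<times> (real ^ 'n) \<Rightarrow> real) \<Rightarrow> real \<times> (real ^ 'n) \<Rightarrow> bool" where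
  "hyperbolic_point h p \<longleftrightarrow>
     h p > 0 \<and> has_signature (\<lambda>v w. - hessian h p v w) CARD('n) 1"

text \<open>
  \<open>H\<close> is a \<open>CARD('n)\<close>-dimensional CCPSR manifold realised in the level set \<open>{h = 1}\<close> of this
  particular \<open>h\<close>.
\<close>

definition CCPSR_manifold ::
    "(real \<times> (real ^ 'n) \<Rightarrow> real) \<Rightarrow> (real \<times> (real ^ 'n)) set \<Rightarrow> bool" where
  "CCPSR_manifold h H \<longleftrightarrow>
     h \<in> homogeneous_cubics \<and>
     H \<noteq> {} \<and> openin (top_of_set {p. h p = 1}) H \<and>
     (\<forall>p\<in>H. hyperbolic_point h p) \<and> connected H \<and> closed H"

definition base_component ::
    "(real \<times> (real ^ 'n) \<Rightarrow> real) \<Rightarrow> (real \<times> (real ^ 'n)) set" where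
  "base_component h = connected_component_set {p. h p = 1} (1, 0)"

text \<open>\<open>D k\<close> is the \<open>k\<close>-th derivative of \<open>f\<close>, one-sided at the boundary of an interval \<open>I\<close>.\<close>

definition smooth_on_interval :: "real set \<Rightarrow> (real \<Rightarrow> real) \<Rightarrow> bool" where
  "smooth_on_interval I f \<longleftrightarrow>
     (\<exists>D. D (0::nat) = f \<and>
          (\<forall>k. \<forall>t\<in>I. (D k has_real_derivative D (Suc k) t) (at t within I)))"

text \<open>
  Smoothness of a curve in the finite-dimensional vector space of cubic forms. The coefficient
  array of a cubic form is unique only up to symmetrisation; as \<open>cubic_form\<close> is linear in the
  array, a curve is smooth iff it lifts to a smooth curve of coefficient arrays.
\<close>

definition smooth_cubic_curve ::
    "real set \<Rightarrow> (real \<Rightarrow> 'a :: euclidean_space \<Rightarrow> real) \<Rightarrow> bool" where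
  "smooth_cubic_curve I \<gamma> \<longleftrightarrow>
     (\<exists>a. (\<forall>t\<in>I. \<gamma> t = cubic_form (a t)) \<and>
          (\<forall>i\<in>Basis. \<forall>j\<in>Basis. \<forall>k\<in>Basis. smooth_on_interval I (\<lambda>t. a t i j k)))"

end

theory Submission
  imports Defs
begin

text \<open>
  The bound \<open>P\<^sub>3 \<le> 2 / (3 \<surd>3)\<close> on the sphere says that \<open>h \<le> 0\<close> on the cone \<open>\<parallel>y\<parallel> = \<surd>3 x\<close> of
  critical points of \<open>h\<close> in the \<open>x\<close>-direction. Hence \<open>{h > 0, \<parallel>y\<parallel> < \<surd>3 x}\<close> is open and closed in
  \<open>{h > 0}\<close>; it is star-shaped about \<open>(1, 0)\<close>, so its intersection with \<open>{h = 1}\<close> is the component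
  of \<open>(1, 0)\<close>. Since \<open>h\<close> is odd, the opposite cone has \<open>h \<ge> 0\<close> on its boundary, and comparing the
  two along tangent lines shows that every point of this set is hyperbolic. The bound on \<open>P\<^sub>3\<close> is
  convex in \<open>P\<^sub>3\<close>.
\<close>

section \<open>Cubic forms and their polarization\<close>

text \<open>Six times the symmetric trilinear form of the cubic.\<close>

definition polar :: "('a \<Rightarrow> 'a \<Rightarrow> 'a \<Rightarrow> real) \<Rightarrow> 'a :: euclidean_space \<Rightarrow> 'a \<Rightarrow> 'a \<Rightarrow> real" where
  "polar a u v w = (\<Sum>i\<in>Basis. \<Sum>j\<in>Basis. \<Sum>k\<in>Basis. a i j k *
     ((u \<bullet> i) * (v \<bullet> j) * (w \<bullet> k) + (u \<bullet> i) * (w \<bullet> j) * (v \<bullet> k) +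
      (v \<bullet> i) * (u \<bullet> j) * (w \<bullet> k) + (v \<bullet> i) * (w \<bullet> j) * (u \<bullet> k) +
      (w \<bullet> i) * (u \<bullet> j) * (v \<bullet> k) + (w \<bullet> i) * (v \<bullet> j) * (u \<bullet> k)))"

lemma polar_sym: "polar a u w v = polar a u v w" "polar a v u w = polar a u v w"
  unfolding polar_def by (simp_all add: algebra_simps)

lemma polar_same: "polar a v v v = 6 * cubic_form a v"
  unfolding polar_def cubic_form_def by (simp add: sum_distrib_left algebra_simps)

lemma linear_polar: "linear (polar a u v)"
  unfolding polar_def
  by (rule linearI)
    (simp_all add: inner_left_distrib sum.distrib[symmetric] sum_distrib_left algebra_simps)

lemma bilinear_polar: "bilinear (polar a u)"
proof -
  have "(\<lambda>v. polar a u v w) = polar a u w" for w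
    by (simp add: fun_eq_iff polar_sym(1))
  then show ?thesis
    unfolding bilinear_def by (simp add: linear_polar)
qed

lemma cubic_form_scaleR: "cubic_form a (r *\<^sub>R v) = r ^ 3 * cubic_form a v"
  unfolding cubic_form_def by (simp add: sum_distrib_left power3_eq_cube mult_ac)

lemma cubic_form_minus: "cubic_form a (- v) = - cubic_form a v"
  using cubic_form_scaleR[of a "-1" v] by simp

text \<open>Taylor's formula, exact for a cubic. As \<open>polar\<close> is six times the symmetric
  trilinear form, \<open>polar a p p v / 2\<close> is the first derivative along \<open>v\<close>
  and \<open>polar a p v v\<close> the second.\<close>

lemma cubic_form_line:
  "cubic_form a (p + t *\<^sub>R v) =
     cubic_form a p + t / 2 * polar a p p v + t\<^sup>2 / 2 * polar a p v v + t ^ 3 * cubic_form a v"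
  unfolding polar_def cubic_form_def sum_distrib_left sum.distrib[symmetric]
  by (intro sum.cong refl)
    (simp add: inner_left_distrib field_simps power2_eq_square power3_eq_cube)

lemma polar_same_half:
  "polar a q q v / 2 = (\<Sum>i\<in>Basis. \<Sum>j\<in>Basis. \<Sum>k\<in>Basis. a i j k *
     ((v \<bullet> i) * (q \<bullet> j) * (q \<bullet> k) + (q \<bullet> i) * (v \<bullet> j) * (q \<bullet> k) +
      (q \<bullet> i) * (q \<bullet> j) * (v \<bullet> k)))"
  unfolding polar_def sum_divide_distrib by (intro sum.cong refl) (simp add: field_simps)

lemma has_derivative_cubic_form:
  "(cubic_form a has_derivative (\<lambda>v. polar a q q v / 2)) (at q)"
  unfolding cubic_form_def[abs_def] polar_same_half
  by (intro has_derivative_sum) (auto intro!: derivative_eq_intros simp: algebra_simps)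

lemma has_derivative_polar:
  "((\<lambda>q. polar a q q v / 2) has_derivative polar a q v) (at q)"
  unfolding polar_same_half unfolding polar_def
  by (intro has_derivative_sum) (auto intro!: derivative_eq_intros simp: algebra_simps)

lemma hessian_cubic_form: "hessian (cubic_form a) p v w = polar a p v w"
proof -
  have "frechet_derivative (cubic_form a) (at q) = (\<lambda>v. polar a q q v / 2)" for q
    by (rule frechet_derivative_at[OF has_derivative_cubic_form, symmetric])
  moreover have "frechet_derivative (\<lambda>q. polar a q q v / 2) (at p) = polar a p v"
    by (rule frechet_derivative_at[OF has_derivative_polar, symmetric])
  ultimately show ?thesis
    by (simp add: hessian_def)
qed

lemma continuous_on_cubic_form: "continuous_on S (cubic_form a)"
  unfolding cubic_form_def[abs_def] by (intro continuous_intros)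

text \<open>Expanding each argument in \<open>Basis\<close> shows that \<open>A\<close> itself
  serves as the coefficient array.\<close>

lemma trilinear_in_homogeneous_cubics:
  fixes A :: "'a::euclidean_space \<Rightarrow> 'a \<Rightarrow> 'a \<Rightarrow> real"
  assumes "\<And>v w. linear (\<lambda>u. A u v w)" "\<And>u w. linear (\<lambda>v. A u v w)" "\<And>u v. linear (A u v)"
  shows "(\<lambda>v. A v v v) \<in> homogeneous_cubics"
proof -
  have "A v v v = cubic_form A v" for v
  proof -
    have 1: "A u v w = (\<Sum>i\<in>Basis. (u \<bullet> i) * A i v w)" for u v w
    proof -
      have "A (\<Sum>i\<in>Basis. (u \<bullet> i) *\<^sub>R i) v w = (\<Sum>i\<in>Basis. (u \<bullet> i) * A i v w)"
        by (simp add: linear_sum[OF assms(1)] linear_cmul[OF assms(1)])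
      then show ?thesis by (simp add: euclidean_representation)
    qed
    have 2: "A u v w = (\<Sum>i\<in>Basis. (v \<bullet> i) * A u i w)" for u v w
    proof -
      have "A u (\<Sum>i\<in>Basis. (v \<bullet> i) *\<^sub>R i) w = (\<Sum>i\<in>Basis. (v \<bullet> i) * A u i w)"
        by (simp add: linear_sum[OF assms(2)] linear_cmul[OF assms(2)])
      then show ?thesis by (simp add: euclidean_representation)
    qed
    have 3: "A u v w = (\<Sum>i\<in>Basis. (w \<bullet> i) * A u v i)" for u v w
    proof -
      have "A u v (\<Sum>i\<in>Basis. (w \<bullet> i) *\<^sub>R i) = (\<Sum>i\<in>Basis. (w \<bullet> i) * A u v i)"
        by (simp add: linear_sum[OF assms(3)] linear_cmul[OF assms(3)])
      then show ?thesis by (simp add: euclidean_representation)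
    qed
    have "A v v v = (\<Sum>i\<in>Basis. (v \<bullet> i) * (\<Sum>j\<in>Basis. (v \<bullet> j) * (\<Sum>k\<in>Basis. (v \<bullet> k) * A i j k)))"
      by (subst 1, subst 2, subst 3) simp
    then show ?thesis
      unfolding cubic_form_def by (simp add: sum_distrib_left mult_ac)
  qed
  then show ?thesis
    unfolding homogeneous_cubics_def by (auto simp: fun_eq_iff)
qed

lemma cubic_form_affine:
  "(\<lambda>v. (1 - t) * cubic_form a v + t * cubic_form b v) =
     cubic_form (\<lambda>i j k. (1 - t) * a i j k + t * b i j k)"
  unfolding cubic_form_def[abs_def] sum_distrib_left sum.distrib[symmetric]
  by (simp add: algebra_simps)

lemma homogeneous_cubics_affine:
  assumes "f \<in> homogeneous_cubics" "g \<in> homogeneous_cubics"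
  shows "(\<lambda>v. (1 - t) * f v + t * g v) \<in> homogeneous_cubics"
  using assms unfolding homogeneous_cubics_def by (auto simp: cubic_form_affine)

section \<open>Orthogonal bases\<close>

text \<open>Gram-Schmidt by induction on the dimension: a nonzero \<open>v\<close> in
  \<open>W\<close> splits off because \<open>\<beta> v v\<close> is nonzero, and the orthogonal
  complement of \<open>v\<close> in \<open>W\<close> inherits the hypothesis.\<close>

lemma orthogonal_basis_exists:
  fixes \<beta> :: "'a::euclidean_space \<Rightarrow> 'a \<Rightarrow> real"
  assumes \<beta>: "bilinear \<beta>" and sym: "\<And>u v. \<beta> u v = \<beta> v u"
    and "subspace W" "\<And>w. w \<in> W \<Longrightarrow> w \<noteq> 0 \<Longrightarrow> \<beta> w w \<noteq> 0"
  shows "\<exists>S. independent S \<and> span S = W \<and> (\<forall>u\<in>S. \<forall>v\<in>S. u \<noteq> v \<longrightarrow> \<beta> u v = 0)"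
  using assms(3,4)
proof (induction "dim W" arbitrary: W rule: less_induct)
  case less
  show ?case
  proof (cases "W = {0}")
    case True
    then show ?thesis by (intro exI[of _ "{}"]) (auto simp: independent_empty)
  next
    case False
    then obtain v where v: "v \<in> W" "v \<noteq> 0"
      using less.prems(1) subspace_0 by blast
    have lin: "linear (\<beta> v)"
      using \<beta> by (simp add: bilinear_def)
    let ?V = "{w \<in> W. \<beta> v w = 0}"
    have sub: "subspace ?V"
      using less.prems(1) lin
      by (auto simp: subspace_def linear_0 linear_add linear_cmul)
    have vV: "v \<notin> ?V"
      using less.prems(2)[OF v] by simp
    have "span ?V \<subset> span W"
      unfolding span_eq_iff[THEN iffD2, OF sub] span_eq_iff[THEN iffD2, OF less.prems(1)]
      using vV v(1) by blast
    then have "dim ?V < dim W"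
      by (rule dim_psubset)
    then obtain S where S: "independent S" "span S = ?V"
        "\<forall>u\<in>S. \<forall>v\<in>S. u \<noteq> v \<longrightarrow> \<beta> u v = 0"
      using less.hyps[OF _ sub] less.prems(2) by auto
    have orth: "\<beta> v s = 0" "s \<in> W" if "s \<in> S" for s
      using span_base[OF that] S(2) by auto
    have "independent (insert v S)"
      using S vV by (simp add: independent_insert)
    moreover have "span (insert v S) = W"
    proof
      show "span (insert v S) \<subseteq> W"
        using v orth less.prems(1) by (intro span_minimal) auto
      show "W \<subseteq> span (insert v S)"
      proof
        fix w assume w: "w \<in> W"
        let ?k = "\<beta> v w / \<beta> v v"
        have "\<beta> v (w - ?k *\<^sub>R v) = 0"
          using less.prems(2)[OF v] by (simp add: linear_diff[OF lin] linear_cmul[OF lin])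
        moreover have "w - ?k *\<^sub>R v \<in> W"
          using less.prems(1) w v(1) by (intro subspace_diff subspace_scale)
        ultimately have "w - ?k *\<^sub>R v \<in> ?V"
          by simp
        then show "w \<in> span (insert v S)"
          unfolding span_insert S(2) by blast
      qed
    qed
    moreover have "\<forall>u\<in>insert v S. \<forall>w\<in>insert v S. u \<noteq> w \<longrightarrow> \<beta> u w = 0"
      using S(3) orth sym by auto
    ultimately show ?thesis by blast
  qed
qed

text \<open>The line of \<open>p\<close> is negative and its orthogonal complement is positive
  definite, so \<open>p\<close> together with an orthogonal basis of the complement diagonalizes the
  form.\<close>

lemma has_signature_lorentzian:
  fixes \<beta> :: "'a::euclidean_space \<Rightarrow> 'a \<Rightarrow> real"
  assumes \<beta>: "bilinear \<beta>" and sym: "\<And>u v. \<beta> u v = \<beta> v u"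
    and neg: "\<beta> p p < 0" and pos: "\<And>v. \<beta> p v = 0 \<Longrightarrow> v \<noteq> 0 \<Longrightarrow> \<beta> v v > 0"
  shows "has_signature \<beta> (DIM('a) - 1) 1"
proof -
  have lin: "linear (\<beta> p)"
    using \<beta> by (simp add: bilinear_def)
  let ?W = "{w. \<beta> p w = 0}"
  have sub: "subspace ?W"
    using lin by (auto simp: subspace_def linear_0 linear_add linear_cmul)
  obtain S where S: "independent S" "span S = ?W" "\<forall>u\<in>S. \<forall>v\<in>S. u \<noteq> v \<longrightarrow> \<beta> u v = 0"
    using orthogonal_basis_exists[OF \<beta> sym sub] pos by force
  have pW: "p \<notin> span S"
    using S(2) neg by simp
  have orth: "\<beta> p s = 0" if "s \<in> S" for s
    using span_base[OF that] S(2) by auto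
  have S_pos: "\<beta> s s > 0" if "s \<in> S" for s
    using orth[OF that] pos that S(1) dependent_zero by metis
  have ind: "independent (insert p S)"
    using S(1) pW by (simp add: independent_insert)
  have span: "span (insert p S) = UNIV"
  proof -
    have "w \<in> span (insert p S)" for w
    proof -
      have "w - (\<beta> p w / \<beta> p p) *\<^sub>R p \<in> ?W"
        using neg lin by (simp add: linear_diff linear_cmul)
      then show ?thesis
        unfolding span_insert S(2) by blast
    qed
    then show ?thesis by blast
  qed
  have "finite S"
    using S(1) by (rule independent_imp_finite)
  moreover have "p \<notin> S"
    using pW span_base by blast
  moreover have "card (insert p S) = DIM('a)"
    using dim_eq_card[OF _ ind, of UNIV] span by simp
  ultimately have card: "card S = DIM('a) - 1"
    by simp
  have "{u \<in> insert p S. \<beta> u u > 0} = S" "{u \<in> insert p S. \<beta> u u < 0} = {p}"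
    using S_pos neg \<open>p \<notin> S\<close> by (auto dest: less_asym)
  moreover have "\<forall>u\<in>insert p S. \<forall>v\<in>insert p S. u \<noteq> v \<longrightarrow> \<beta> u v = 0"
    using S(3) orth sym by auto
  ultimately show ?thesis
    unfolding has_signature_def using \<beta> ind span card
    by (intro conjI exI[of _ "insert p S"]) auto
qed

text \<open>Intermediate values: the image of \<open>C\<close> is an interval that omits 0.\<close>

lemma connected_pos:
  fixes f :: "'a::topological_space \<Rightarrow> real"
  assumes "connected C" "continuous_on C f" "\<And>q. q \<in> C \<Longrightarrow> f q \<noteq> 0"
    and "p \<in> C" "f p > 0" "q \<in> C"
  shows "f q > 0"
proof (rule ccontr)
  assume "\<not> f q > 0"
  moreover have "connected (f ` C)"
    using assms(1,2) by (rule connected_continuous_image[rotated])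
  ultimately have "0 \<in> f ` C"
    using connected_contains_Icc[of "f ` C" "f q" "f p"] assms(4-6) by auto
  then show False
    using assms(3) by auto
qed

section \<open>Elements of the generating set\<close>

lemma standard_form_in_homogeneous_cubics:
  fixes P :: "real ^ 'n \<Rightarrow> real"
  assumes "P \<in> homogeneous_cubics"
  shows "standard_form P \<in> homogeneous_cubics"
proof -
  obtain a where P: "P = cubic_form a"
    using assms by (auto simp: homogeneous_cubics_def)
  \<comment> \<open>Only the diagonal of \<open>A\<close> has to give
    \<open>standard_form P\<close>, so the term \<open>x * (y \<bullet> y)\<close> is left
    unsymmetrized. Dividing by 6 undoes the factor in \<open>polar_same\<close>.\<close>
  define A :: "real \<times> (real ^ 'n) \<Rightarrow> real \<times> (real ^ 'n) \<Rightarrow> real \<times> (real ^ 'n) \<Rightarrow> real"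
    where "A u v w = fst u * fst v * fst w - fst u * (snd v \<bullet> snd w) +
      polar a (snd u) (snd v) (snd w) / 6"
    for u v w
  have lin: "linear (\<lambda>w. polar a u v (snd w))" for u v :: "real ^ 'n"
    using linear_compose[OF linear_snd linear_polar] by (simp add: o_def)
  have swap: "polar a u v w = polar a v w u" "polar a u v w = polar a u w v" for u v w
    by (simp_all add: polar_sym)
  note L = linear_add[OF lin] linear_cmul[OF lin]
  have "(\<lambda>v. A v v v) \<in> homogeneous_cubics"
  proof (rule trilinear_in_homogeneous_cubics[of A])
    show "linear (\<lambda>u. A u v w)" for v w
      unfolding A_def swap(1)[of "snd _" "snd v" "snd w"]
      by (rule linearI) (simp_all add: L[simplified] algebra_simps add_divide_distrib)
    show "linear (\<lambda>v. A u v w)" for u w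
      unfolding A_def swap(2)[of "snd u" "snd _" "snd w"]
      by (rule linearI) (simp_all add: L[simplified] algebra_simps add_divide_distrib inner_left_distrib)
    show "linear (A u v)" for u v
      unfolding A_def
      by (rule linearI) (simp_all add: L[simplified] algebra_simps add_divide_distrib inner_right_distrib)
  qed
  moreover have "standard_form P = (\<lambda>v. A v v v)"
    by (simp add: standard_form_def A_def P polar_same fun_eq_iff power3_eq_cube)
  ultimately show ?thesis by simp
qed

text \<open>Homogeneity carries a bound on the unit sphere to all vectors. Compactness bounds the
  values above, so that the real supremum is a genuine least upper bound.\<close>

lemma SUP_sphere_le_iff:
  fixes P :: "real ^ 'n \<Rightarrow> real"
  assumes "P \<in> homogeneous_cubics"
  shows "(SUP y\<in>sphere 0 1. P y) \<le> c \<longleftrightarrow> (\<forall>y. P y \<le> c * norm y ^ 3)"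
proof -
  obtain a where P: "P = cubic_form a"
    using assms by (auto simp: homogeneous_cubics_def)
  have ne: "sphere (0 :: real ^ 'n) 1 \<noteq> {}"
    by simp
  have "compact (P ` sphere 0 1)"
    unfolding P by (intro compact_continuous_image continuous_on_cubic_form compact_sphere)
  then have bdd: "bdd_above (P ` sphere 0 1)"
    by (intro bounded_imp_bdd_above compact_imp_bounded)
  have "(\<forall>y\<in>sphere 0 1. P y \<le> c) \<longleftrightarrow> (\<forall>y. P y \<le> c * norm y ^ 3)"
  proof safe
    fix y :: "real ^ 'n"
    assume *: "\<forall>y\<in>sphere 0 1. P y \<le> c"
    show "P y \<le> c * norm y ^ 3"
    proof (cases "y = 0")
      case True
      then show ?thesis using cubic_form_scaleR[of a 0 y] P by simp
    next
      case False
      then have "P y = norm y ^ 3 * P (sgn y)"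
        using cubic_form_scaleR[of a "norm y" "sgn y"] P by (simp add: sgn_div_norm)
      moreover have "P (sgn y) \<le> c"
        using * False by (simp add: norm_sgn)
      ultimately show ?thesis
        by (simp add: mult.commute mult_right_mono)
    qed
  next
    fix y :: "real ^ 'n"
    assume "\<forall>y. P y \<le> c * norm y ^ 3" "y \<in> sphere 0 1"
    then show "P y \<le> c"
      by (metis mem_sphere_0 mult.right_neutral power_one)
  qed
  then show ?thesis
    using cSUP_le_iff[OF ne bdd] by simp
qed

section \<open>The cone of positivity around the base point\<close>

locale generating_cubic =
  fixes P :: "real ^ 'n \<Rightarrow> real" and h :: "real \<times> (real ^ 'n) \<Rightarrow> real"
  assumes P_cubic: "P \<in> homogeneous_cubics"
    and P_le: "P y \<le> 2 / (3 * sqrt 3) * norm y ^ 3"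
    and h_def: "h = standard_form P"
begin

text \<open>The second condition says \<open>x > 0\<close> and
  \<open>3 x^2 - (norm y)^2 > 0\<close>. The latter is the derivative of \<open>h\<close> in the
  direction of \<open>x\<close>, so \<open>h\<close> increases with \<open>x\<close> there.\<close>

definition cone :: "(real \<times> (real ^ 'n)) set" where
  "cone = {p. h p > 0 \<and> norm (snd p) < sqrt 3 * fst p}"

lemma h_eq: "h (x, y) = x ^ 3 - x * (norm y)\<^sup>2 + P y"
  by (simp add: h_def standard_form_def dot_square_norm)

lemma h_cubic: "h \<in> homogeneous_cubics"
  using standard_form_in_homogeneous_cubics[OF P_cubic] h_def by simp

lemma h_minus: "h (- p) = - h p"
  using h_cubic by (auto simp: homogeneous_cubics_def cubic_form_minus)

lemma continuous_on_h: "continuous_on S h"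
  using h_cubic by (auto simp: homogeneous_cubics_def continuous_on_cubic_form)

lemma h_base: "h (1, 0) = 1"
proof -
  have "P 0 = 0"
    using P_cubic by (auto simp: homogeneous_cubics_def cubic_form_def)
  then show ?thesis by (simp add: h_eq)
qed

text \<open>On this set the terms without \<open>P\<close> add up to \<open>-2 x^3\<close>, and the
  constant \<open>2 / (3 * sqrt 3)\<close> is just what bounds \<open>P y\<close> by
  \<open>2 x^3\<close>.\<close>

lemma h_boundary:
  assumes "norm (snd p) = sqrt 3 * fst p"
  shows "h p \<le> 0"
proof -
  obtain x y where p: "p = (x, y)" by fastforce
  have y: "norm y = sqrt 3 * x"
    using assms p by simp
  have s: "sqrt 3 * sqrt 3 = (3::real)" by simp
  have "P y \<le> 2 / (3 * sqrt 3) * (sqrt 3 * x) ^ 3"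
    using P_le[of y] y by simp
  also have "\<dots> = 2 * x ^ 3"
    using s by (simp add: power3_eq_cube field_simps)
  finally show ?thesis
    unfolding p h_eq y by (simp add: power_mult_distrib) (simp add: power2_eq_square power3_eq_cube)
qed

lemma h_boundary_opposite:
  assumes "norm (snd p) = - sqrt 3 * fst p"
  shows "h p \<ge> 0"
  using h_boundary[of "- p"] assms by (simp add: h_minus)

lemma base_in_cone: "(1, 0) \<in> cone"
  by (simp add: cone_def h_base)

text \<open>Positivity of \<open>h\<close> keeps \<open>C\<close> off the boundary
  \<open>norm y = sqrt 3 * x\<close>, by \<open>h_boundary\<close>, so
  \<open>sqrt 3 * x - norm y\<close> keeps its sign on \<open>C\<close>.\<close>

lemma connected_subset_cone:
  assumes "connected C" "p \<in> C" "p \<in> cone" "\<And>q. q \<in> C \<Longrightarrow> h q > 0"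
  shows "C \<subseteq> cone"
proof
  fix q assume q: "q \<in> C"
  have "sqrt 3 * fst q - norm (snd q) > 0"
  proof (rule connected_pos[OF assms(1) _ _ assms(2) _ q])
    show "continuous_on C (\<lambda>q. sqrt 3 * fst q - norm (snd q))"
      by (intro continuous_intros)
    show "sqrt 3 * fst q - norm (snd q) \<noteq> 0" if "q \<in> C" for q
      using assms(4)[OF that] h_boundary[of q] by force
    show "sqrt 3 * fst p - norm (snd p) > 0"
      using assms(3) by (simp add: cone_def)
  qed
  then show "q \<in> cone"
    using assms(4)[OF q] by (simp add: cone_def)
qed

section \<open>Hyperbolicity of the points of the cone\<close>

lemma line_in_cone:
  assumes "p \<in> cone" "is_interval I" "0 \<in> I" "\<And>t. t \<in> I \<Longrightarrow> h (p + t *\<^sub>R v) > 0" "t \<in> I"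
  shows "p + t *\<^sub>R v \<in> cone"
proof -
  have "connected ((\<lambda>t. p + t *\<^sub>R v) ` I)"
    using assms(2) by (intro connected_continuous_image continuous_intros)
      (simp add: is_interval_connected_1)
  moreover have "p \<in> (\<lambda>t. p + t *\<^sub>R v) ` I"
    using assms(3) by (force intro: image_eqI[of _ _ 0])
  ultimately have "(\<lambda>t. p + t *\<^sub>R v) ` I \<subseteq> cone"
    using assms(1,4) by (intro connected_subset_cone) auto
  then show ?thesis
    using assms(5) by blast
qed

text \<open>
  If the second derivative in the direction \<open>v\<close> were nonnegative, then (up to the sign of \<open>v\<close>)
  the cubic \<open>t \<mapsto> h (p + t v)\<close> would be positive on an interval \<open>(t\<^sub>0, \<infinity>)\<close> containing \<open>0\<close> and
  negative before. The line would stay in \<^term>\<open>cone\<close> over that interval, so it is impossible that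
  \<open>t\<^sub>0 = -\<infinity>\<close>. As \<open>t \<rightarrow> -\<infinity>\<close> it has to enter the opposite cone, through a boundary point where
  \<open>h \<ge> 0\<close>. So it leaves one cone and enters the other at the same point, the origin; but then
  \<open>v\<close> is parallel to \<open>p\<close>, which is not tangent.
\<close>

lemma polar_neg_aux:
  assumes h: "h = cubic_form a" and p: "p \<in> cone" and "v \<noteq> 0" and tangent: "polar a p p v = 0"
    and nonneg: "polar a p v v \<ge> 0" and hv: "h v \<ge> 0"
  shows False
proof -
  obtain x y where xy: "p = (x, y)" by fastforce
  obtain c d where cd: "v = (c, d)" by fastforce
  define \<alpha> \<beta> where "\<alpha> = h p" and "\<beta> = polar a p v v / 2"
  have \<alpha>: "\<alpha> > 0" and \<beta>: "\<beta> \<ge> 0"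
    using p nonneg by (auto simp: \<alpha>_def \<beta>_def cone_def)
  have g: "h (p + t *\<^sub>R v) = \<alpha> + \<beta> * t\<^sup>2 + h v * t ^ 3" for t
    using tangent by (simp add: h cubic_form_line \<alpha>_def \<beta>_def)
  have cone_line: "norm (y + t *\<^sub>R d) < sqrt 3 * (x + t * c)" if "p + t *\<^sub>R v \<in> cone" for t
    using that by (simp add: cone_def xy cd)
  have d_bound: "\<bar>t\<bar> * norm d \<le> norm (y + t *\<^sub>R d) + norm y" for t
    using norm_triangle_ineq4[of "y + t *\<^sub>R d" y] by simp
  have ray: "p + t *\<^sub>R v \<in> cone" if "t \<ge> 0" for t
  proof (rule line_in_cone[OF p, of "{0..}"])
    show "h (p + t *\<^sub>R v) > 0" if "t \<in> {0..}" for t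
    proof -
      have "\<beta> * t\<^sup>2 \<ge> 0" "h v * t ^ 3 \<ge> 0"
        using that \<beta> hv by auto
      then show ?thesis
        using \<alpha> g[of t] by linarith
    qed
  qed (use that in auto)
  have slope: "norm d \<le> sqrt 3 * c"
  proof (rule ccontr)
    assume "\<not> norm d \<le> sqrt 3 * c"
    then have e: "norm d - sqrt 3 * c > 0" by simp
    \<comment> \<open>At this parameter the triangle inequality already pushes the ray out of the
      cone.\<close>
    define t where "t = (sqrt 3 * x + norm y) / (norm d - sqrt 3 * c)"
    have "norm y < sqrt 3 * x"
      using cone_line[OF ray[of 0]] by simp
    then have "t \<ge> 0"
      unfolding t_def using e norm_ge_zero[of y] by (intro divide_nonneg_pos) linarith+
    have "t * (norm d - sqrt 3 * c) = sqrt 3 * x + norm y"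
      using e by (simp add: t_def)
    moreover have "t * norm d \<le> norm (y + t *\<^sub>R d) + norm y"
      using d_bound[of t] \<open>t \<ge> 0\<close> by simp
    moreover have "norm (y + t *\<^sub>R d) < sqrt 3 * (x + t * c)"
      using cone_line ray \<open>t \<ge> 0\<close> by blast
    ultimately show False
      by (simp add: algebra_simps)
  qed
  show False
  proof (cases "h v = 0")
    case True
    have line: "p + t *\<^sub>R v \<in> cone" for t
      using \<alpha> \<beta> by (intro line_in_cone[OF p, of UNIV]) (auto simp: g True intro: add_pos_nonneg)
    \<comment> \<open>The whole line lies in the cone, where the first coordinate is positive, so
      that coordinate cannot vanish at any parameter.\<close>
    have "c = 0"
    proof (rule ccontr)
      assume "c \<noteq> 0"
      then show False
        using cone_line[OF line[of "- x / c"]] by simp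
    qed
    then have "d = 0"
      using slope by simp
    then show False
      using \<open>c = 0\<close> \<open>v \<noteq> 0\<close> cd by (simp add: zero_prod_def)
  next
    case False
    then have \<delta>: "h v > 0"
      using hv by simp
    \<comment> \<open>Equality would put \<open>v\<close> on the boundary of the cone, where
      \<open>h\<close> is at most 0.\<close>
    then have slope': "norm d < sqrt 3 * c"
      using slope h_boundary[of v] cd by fastforce
    \<comment> \<open>\<open>F\<close> is positive in the cone and vanishes exactly where the line
      meets the boundary of the opposite cone.\<close>
    define F where "F t = sqrt 3 * (x + t * c) + norm (y + t *\<^sub>R d)" for t
    have F0: "F 0 > 0"
      using cone_line[OF ray[of 0]] norm_ge_zero[of y] unfolding F_def by (simp del: norm_ge_zero)
    \<comment> \<open>The zero of the affine function that bounds \<open>F\<close> from above for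
      negative parameters.\<close>
    define T where "T = - F 0 / (sqrt 3 * c - norm d)"
    have T: "T < 0"
      unfolding T_def using F0 slope' by (simp add: divide_neg_pos)
    have "F T \<le> F 0 + T * (sqrt 3 * c - norm d)"
      using norm_triangle_ineq[of y "T *\<^sub>R d"] T unfolding F_def by (simp add: algebra_simps)
    also have "\<dots> = 0"
      using slope' by (simp add: T_def)
    finally have "F T \<le> 0" .
    moreover have "continuous_on {T..0} F"
      unfolding F_def by (intro continuous_intros)
    ultimately obtain t where t: "T \<le> t" "t \<le> 0" "F t = 0"
      using IVT'[of F T 0 0] F0 T by auto
    have t0: "t < 0"
      using t F0 by (cases "t = 0") auto
    have "h (p + t *\<^sub>R v) \<ge> 0"
      using t(3) by (intro h_boundary_opposite) (simp add: F_def xy cd)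
    \<comment> \<open>In terms of \<open>- t > 0\<close>, the value of \<open>h\<close> is
      \<open>\<alpha>\<close> minus this product. The product strictly increases with
      \<open>- t\<close> wherever its second factor is positive, so \<open>h\<close> stays positive
      between \<open>t\<close> and 0.\<close>
    then have gt: "(- t)\<^sup>2 * (h v * (- t) - \<beta>) \<le> \<alpha>"
      unfolding g by (simp add: algebra_simps power2_eq_square power3_eq_cube)
    have seg: "p + s *\<^sub>R v \<in> cone" if "t < s" for s
    proof (rule line_in_cone[OF p, of "{t<..}"])
      fix s assume "s \<in> {t<..}"
      then have s: "t < s" by simp
      show "h (p + s *\<^sub>R v) > 0"
      proof (cases "s \<ge> 0")
        case True
        then show ?thesis using ray by (simp add: cone_def)
      next
        case False
        have "(- s)\<^sup>2 * (h v * (- s) - \<beta>) < \<alpha>"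
        proof (cases "h v * (- s) - \<beta> \<le> 0")
          case True
          then show ?thesis
            using \<alpha> by (meson mult_nonneg_nonpos zero_le_power2 order_le_less_trans)
        next
          case nonpos: False
          have "h v * (- s) < h v * (- t)"
            using s \<delta> by (intro mult_strict_left_mono) auto
          moreover have "(- s)\<^sup>2 < (- t)\<^sup>2"
            using s False by (intro power_strict_mono) auto
          ultimately have "(- s)\<^sup>2 * (h v * (- s) - \<beta>) < (- t)\<^sup>2 * (h v * (- t) - \<beta>)"
            using nonpos by (intro mult_strict_mono) auto
          then show ?thesis using gt by linarith
        qed
        then show ?thesis
          unfolding g by (simp add: algebra_simps power2_eq_square power3_eq_cube)
      qed
    qed (use that t0 in auto)
    \<comment> \<open>Letting \<open>s\<close> decrease to \<open>t\<close> puts the point at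
      \<open>t\<close> in the closure of the cone. It also lies in the closed opposite cone, and the
      two share only the origin.\<close>
    have "sqrt 3 * (x + t * c) - norm (y + t *\<^sub>R d) \<ge> 0"
    proof (rule tendsto_lowerbound)
      show "((\<lambda>s. sqrt 3 * (x + s * c) - norm (y + s *\<^sub>R d)) \<longlongrightarrow>
          sqrt 3 * (x + t * c) - norm (y + t *\<^sub>R d)) (at_right t)"
        by (intro tendsto_intros)
      show "\<forall>\<^sub>F s in at_right t. 0 \<le> sqrt 3 * (x + s * c) - norm (y + s *\<^sub>R d)"
        using cone_line seg by (fastforce simp: eventually_at_right_field intro: exI[of _ "t + 1"])
    qed simp
    with t(3) have "norm (y + t *\<^sub>R d) = 0" "sqrt 3 * (x + t * c) = 0"
      unfolding F_def using norm_ge_zero[of "y + t *\<^sub>R d"] by linarith+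
    then have "y + t *\<^sub>R d = 0" "x + t * c = 0"
      by simp_all
    then have "p = (- t) *\<^sub>R v"
      by (simp add: xy cd eq_neg_iff_add_eq_0)
    then have "polar a p p p = 0"
      using tangent linear_cmul[OF linear_polar, of a p p "- t" v] by simp
    then show False
      using \<alpha> by (simp add: polar_same \<alpha>_def h)
  qed
qed

text \<open>Passing from \<open>v\<close> to \<open>- v\<close> keeps the second derivative and
  changes the sign of \<open>h v\<close>, so \<open>h v \<ge> 0\<close> may be assumed.\<close>

lemma polar_neg:
  assumes h: "h = cubic_form a" and p: "p \<in> cone" and v: "v \<noteq> 0" "polar a p p v = 0"
  shows "polar a p v v < 0"
proof (rule ccontr)
  assume *: "\<not> polar a p v v < 0"
  have m: "polar a p u (- w) = - polar a p u w" for u w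
    using linear_polar by (rule linear_neg)
  have "polar a p (- v) (- v) = polar a p v v"
    using m polar_sym(1)[of a p v] by (metis minus_minus)
  then show False
    using polar_neg_aux[OF h p, of v] polar_neg_aux[OF h p, of "- v"] v * m[of p v] h_minus[of v]
    by (cases "h v \<ge> 0") auto
qed

text \<open>By Euler's identity \<open>p\<close> is itself a negative direction of the negated
  Hessian, and its orthogonal complement consists of the tangent directions treated in
  \<open>polar_neg\<close>.\<close>

lemma hyperbolic_point_cone:
  assumes "p \<in> cone"
  shows "hyperbolic_point h p"
proof -
  obtain a where h: "h = cubic_form a"
    using h_cubic by (auto simp: homogeneous_cubics_def)
  let ?\<beta> = "\<lambda>v w. - polar a p v w"
  have "bilinear ?\<beta>"
    using bilinear_polar[of a p] by (simp add: bilinear_def linear_compose_neg)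
  moreover have "?\<beta> p p < 0"
    using assms by (simp add: polar_same cone_def flip: h)
  moreover have "?\<beta> v v > 0" if "?\<beta> p v = 0" "v \<noteq> 0" for v
    using polar_neg[OF h assms] that by simp
  ultimately have "has_signature ?\<beta> (DIM(real \<times> (real ^ 'n)) - 1) 1"
    by (intro has_signature_lorentzian) (auto simp: polar_sym(1))
  then show ?thesis
    using assms by (simp add: hyperbolic_point_def cone_def hessian_cubic_form flip: h)
      (simp add: h hessian_cubic_form)
qed

section \<open>The component of the base point and its closedness\<close>

lemma starlike_cone: "starlike cone"
  unfolding starlike_def
proof (intro bexI ballI subsetI)
  fix p q assume p: "p \<in> cone" and q: "q \<in> closed_segment (1, 0) p"
  obtain x y where xy: "p = (x, y)" by fastforce
  obtain u where u: "0 \<le> u" "u \<le> 1" "q = (1 - u + u * x, u *\<^sub>R y)"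
    using q unfolding closed_segment_def xy by auto
  show "q \<in> cone"
  proof (cases "u = 0")
    case True
    then show ?thesis using u base_in_cone by simp
  next
    case False
    then have u0: "u > 0" using u by simp
    \<comment> \<open>Compare \<open>q = (X, u *\<^sub>R y)\<close> with
      \<open>u *\<^sub>R p = (Z, u *\<^sub>R y)\<close>, where \<open>h\<close> is positive by
      homogeneity. The values of \<open>h\<close> differ only in \<open>x^3 - x r^2\<close>, which
      increases in \<open>x\<close> from \<open>r / sqrt 3\<close> on.\<close>
    define X Z r where "X = 1 - u + u * x" and "Z = u * x" and "r = norm (u *\<^sub>R y)"
    have y: "norm y < sqrt 3 * x" "h p > 0"
      using p by (auto simp: cone_def xy)
    have rZ: "r < sqrt 3 * Z"
      using y(1) u0 by (simp add: r_def Z_def mult.left_commute)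
    have XZ: "Z \<le> X"
      using u by (simp add: X_def Z_def)
    have r: "r \<ge> 0"
      by (simp add: r_def)
    have Z: "Z > 0"
      using rZ r by (smt (verit) real_sqrt_gt_zero zero_less_mult_pos)
    have "r\<^sup>2 \<le> (sqrt 3 * Z)\<^sup>2"
      using rZ r by (intro power_mono) auto
    then have "r\<^sup>2 \<le> 3 * Z\<^sup>2"
      by (simp add: power_mult_distrib)
    moreover have "Z\<^sup>2 \<le> X\<^sup>2" "Z\<^sup>2 \<le> X * Z"
      using XZ Z by (auto intro: power_mono) (simp add: power2_eq_square)
    \<comment> \<open>The product is the difference of \<open>x^3 - x r^2\<close> at
      \<open>X\<close> and at \<open>Z\<close>. Its second factor is nonnegative because each of its
      three positive terms is at least \<open>Z^2\<close>.\<close>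
    ultimately have "(X - Z) * (X\<^sup>2 + X * Z + Z\<^sup>2 - r\<^sup>2) \<ge> 0"
      using XZ by (intro mult_nonneg_nonneg) auto
    then have mono: "Z ^ 3 - Z * r\<^sup>2 \<le> X ^ 3 - X * r\<^sup>2"
      by (simp add: algebra_simps power2_eq_square power3_eq_cube)
    have "h (u *\<^sub>R p) = u ^ 3 * h p"
      using h_cubic by (auto simp: homogeneous_cubics_def cubic_form_scaleR)
    then have "h (Z, u *\<^sub>R y) > 0"
      using y(2) u0 by (simp add: xy Z_def)
    then have "h q > 0"
      using mono u(3) by (simp add: h_eq X_def r_def)
    moreover have "r < sqrt 3 * X"
      using rZ XZ by (meson less_le_trans mult_left_mono real_sqrt_ge_zero zero_le_numeral)
    then have "norm (snd q) < sqrt 3 * fst q"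
      unfolding u(3) r_def X_def by simp
    ultimately show ?thesis
      by (simp add: cone_def)
  qed
qed (rule base_in_cone)

text \<open>Dividing by the cube root of \<open>h\<close> retracts the connected cone onto its part
  in the level set; positive scaling preserves the cone.\<close>

lemma connected_cone_level: "connected (cone \<inter> {p. h p = 1})"
proof -
  let ?f = "\<lambda>p. (1 / root 3 (h p)) *\<^sub>R p"
  have "continuous_on cone ?f"
    by (intro continuous_intros continuous_on_h) (auto simp: cone_def)
  then have "connected (?f ` cone)"
    using starlike_cone by (intro connected_continuous_image starlike_imp_connected)
  moreover have "?f p \<in> cone \<inter> {p. h p = 1}" if p: "p \<in> cone" for p
  proof -
    have hs: "h (?f p) = (1 / root 3 (h p)) ^ 3 * h p"
      using h_cubic by (auto simp: homogeneous_cubics_def cubic_form_scaleR)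
    have hp: "h p > 0"
      using p by (simp add: cone_def)
    then have h1: "h (?f p) = 1"
      unfolding hs by (simp add: power_divide)
    have "norm (snd p) / root 3 (h p) < sqrt 3 * fst p / root 3 (h p)"
      using p hp by (intro divide_strict_right_mono) (auto simp: cone_def)
    then show ?thesis
      using h1 hp by (simp add: cone_def)
  qed
  moreover have "p \<in> ?f ` cone" if "p \<in> cone \<inter> {p. h p = 1}" for p
    using that by (intro image_eqI[of _ _ p]) auto
  ultimately have "connected (?f ` cone)" "?f ` cone = cone \<inter> {p. h p = 1}"
    by blast+
  then show ?thesis by simp
qed

text \<open>The component cannot leave the cone, since \<open>h = 1 > 0\<close> on it; conversely
  the level set inside the cone is connected and contains the base point.\<close>

lemma base_component_eq: "base_component h = cone \<inter> {p. h p = 1}"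
proof
  show "base_component h \<subseteq> cone \<inter> {p. h p = 1}"
    unfolding base_component_def
    using connected_subset_cone[of "connected_component_set {p. h p = 1} (1, 0)" "(1, 0)"]
      connected_component_subset[of "{p. h p = 1}" "(1, 0)"] base_in_cone h_base
    by (fastforce simp: connected_component_refl_eq)
  show "cone \<inter> {p. h p = 1} \<subseteq> base_component h"
    unfolding base_component_def
    using connected_cone_level base_in_cone h_base by (intro connected_component_maximal) auto
qed

lemma base_in_base_component: "(1, 0) \<in> base_component h"
  by (simp add: base_component_eq base_in_cone h_base)

text \<open>Closed as a component of a closed set, relatively open because the cone is open.\<close>

lemma CCPSR_manifold_base_component: "CCPSR_manifold h (base_component h)"
proof -
  have "closed {p. h p = 1}"
    by (intro closed_Collect_eq continuous_on_h continuous_intros)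
  then have "closed (base_component h)"
    unfolding base_component_def by (rule closed_connected_component)
  moreover have "open cone"
    unfolding cone_def
    by (intro open_Collect_conj open_Collect_less continuous_on_h continuous_intros)
  then have "openin (top_of_set {p. h p = 1}) (base_component h)"
    unfolding base_component_eq by (metis Int_commute openin_open_Int)
  moreover have "connected (base_component h)"
    unfolding base_component_def by simp
  ultimately show ?thesis
    unfolding CCPSR_manifold_def
    using h_cubic base_in_base_component hyperbolic_point_cone base_component_eq by auto
qed

end

section \<open>Convexity of the generating set and the affine curve\<close>

lemma generating_set_iff: "h \<in> generating_set \<longleftrightarrow> (\<exists>P. generating_cubic P h)"
  unfolding generating_set_def generating_cubic_def
  using SUP_sphere_le_iff by blast

text \<open>\<open>standard_form\<close> is affine in \<open>P\<close>, so mixing the cubics mixes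
  their \<open>P\<close> parts with the same weights, and the pointwise upper bound
  survives.\<close>

lemma generating_cubic_convex_comb:
  assumes "generating_cubic P h" "generating_cubic P' h'" "t \<in> {0..1}"
  shows "generating_cubic (\<lambda>y. (1 - t) * P y + t * P' y) (\<lambda>p. (1 - t) * h p + t * h' p)"
proof -
  interpret h: generating_cubic P h by fact
  interpret h': generating_cubic P' h' by fact
  show ?thesis
  proof
    show "(\<lambda>y. (1 - t) * P y + t * P' y) \<in> homogeneous_cubics"
      using h.P_cubic h'.P_cubic by (rule homogeneous_cubics_affine)
    show "(1 - t) * P y + t * P' y \<le> 2 / (3 * sqrt 3) * norm y ^ 3" for y
      using h.P_le h'.P_le assms(3) by (intro convex_bound_le) auto
    show "(\<lambda>p. (1 - t) * h p + t * h' p) = standard_form (\<lambda>y. (1 - t) * P y + t * P' y)"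
      by (auto simp: h.h_def h'.h_def standard_form_def fun_eq_iff algebra_simps)
  qed
qed

lemma smooth_on_interval_affine: "smooth_on_interval I (\<lambda>t. (1 - t) * a + t * b)"
  unfolding smooth_on_interval_def
proof (intro exI[of _ "\<lambda>k t. if k = 0 then (1 - t) * a + t * b else if k = 1 then b - a else 0"]
    conjI allI ballI)
  fix k :: nat and t :: real
  show "((\<lambda>t. if k = 0 then (1 - t) * a + t * b else if k = 1 then b - a else 0) has_real_derivative
      (if Suc k = 0 then (1 - t) * a + t * b else if Suc k = 1 then b - a else 0)) (at t within I)"
    by (cases "k = 0") (auto intro!: derivative_eq_intros)
qed simp

text \<open>The curve lifts to the straight line between two coefficient arrays.\<close>

lemma smooth_cubic_curve_affine:
  assumes "f \<in> homogeneous_cubics" "g \<in> homogeneous_cubics"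
  shows "smooth_cubic_curve I (\<lambda>t p. (1 - t) * f p + t * g p)"
proof -
  obtain a b where ab: "f = cubic_form a" "g = cubic_form b"
    using assms by (auto simp: homogeneous_cubics_def)
  show ?thesis
    unfolding smooth_cubic_curve_def ab
    by (intro exI[of _ "\<lambda>t i j k. (1 - t) * a i j k + t * b i j k"])
      (simp add: cubic_form_affine smooth_on_interval_affine)
qed

theorem corollary4p17:
  fixes h h' :: "real \<times> (real ^ 'n) \<Rightarrow> real"
    and H H' :: "(real \<times> (real ^ 'n)) set"
    and \<gamma> :: "real \<Rightarrow> real \<times> (real ^ 'n) \<Rightarrow> real"
  assumes "h \<in> generating_set" and "h' \<in> generating_set"
    and "H = base_component h" and "H' = base_component h'"
    and "\<gamma> = (\<lambda>t p. (1 - t) * h p + t * h' p)"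
  shows "smooth_cubic_curve {0..1} \<gamma> \<and> \<gamma> ` {0..1} \<subseteq> generating_set \<and>
    (\<forall>t\<in>{0..1}. (1, 0) \<in> base_component (\<gamma> t) \<and>
       CCPSR_manifold (\<gamma> t) (base_component (\<gamma> t))) \<and>
    base_component (\<gamma> 0) = H \<and> base_component (\<gamma> 1) = H'"
proof -
  obtain P P' where P: "generating_cubic P h" "generating_cubic P' h'"
    using assms(1,2) generating_set_iff by blast
  have \<gamma>: "generating_cubic (\<lambda>y. (1 - t) * P y + t * P' y) (\<gamma> t)" if "t \<in> {0..1}" for t
    unfolding assms(5) using P that by (rule generating_cubic_convex_comb)
  have "smooth_cubic_curve {0..1} \<gamma>"
    unfolding assms(5) using P[THEN generating_cubic.h_cubic] by (rule smooth_cubic_curve_affine)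
  moreover have "\<gamma> ` {0..1} \<subseteq> generating_set"
    using \<gamma> generating_set_iff by blast
  moreover have "\<forall>t\<in>{0..1}. (1, 0) \<in> base_component (\<gamma> t) \<and>
      CCPSR_manifold (\<gamma> t) (base_component (\<gamma> t))"
    using \<gamma> generating_cubic.base_in_base_component generating_cubic.CCPSR_manifold_base_component
    by blast
  moreover have "\<gamma> 0 = h" "\<gamma> 1 = h'"
    by (simp_all add: assms(5))
  ultimately show ?thesis
    using assms(3,4) by simp
qed

end
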